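(* Let $\Omega$ and $A$ be sets, $(T,\eta,\mu)$ a monad on $\mathbf{Sets}$ and $t\colon T(\Omega)\to\Omega$ an Eilenberg-Moore algebra. Let $B(X)=\Omega\times X^A$, and define $\kappa_X=(t\times\mathrm{st})\circ\langle T(\pi_1),T(\pi_2)\rangle\colon T(\Omega\times X^A)\to\Omega\times T(X)^A$, $\tau_X=t^X\circ\mathrm{st}\colon T(\Omega^X)\to\Omega^X$, and $\delta_X\colon\Omega\times(\Omega^X)^A\to\Omega^{A\times X+1}$ by $\delta_X(\omega,g)(\ast)=\omega$ and $\delta_X(\omega,g)(a,x)=g(a)(x)$. Then $\delta_X\circ(\mathrm{id}\times(\tau_X)^A)\circ\kappa_{\Omega^X}=\tau_{A\times X+1}\circ T(\delta_X)$ for every set $X$. Moreover, there is a bijection $\mathsf{e}\colon\Omega^{A^*}\to\Omega^{A^*}$ such that for every coalgebra $c=\langle o,f\rangle\colon X\to\Omega\times T(X)^A$ we have $\mathsf{e}\circ\mathsf{em}_c=\mathsf{log}_c$, where: $\mathsf{em}_c\colon X\to\Omega^{A^*}$ is the unique map with $\mathsf{em}_c=\zeta^{-1}\circ B(a)\circ BT(\mathsf{em}_c)\circ c$, for $\zeta\colon\Omega^{A^*}\to\Omega\times(\Omega^{A^*})^A$, $\zeta(\varphi)=(\varphi(\varepsilon),\lambda b.\lambda w.\varphi(bw))$ and $a=t^{A^*}\circ\mathrm{st}\colon T(\Omega^{A^*})\to\Omega^{A^*}$; and $\mathsf{log}_c\colon X\to\Omega^{A^*}$ is the unique map with $\mathsf{log}_c(x)(\varepsilon)=o(x)$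 and $\mathsf{log}_c(x)(bw)=t\big(T(\mathrm{ev}_w\circ\mathsf{log}_c)(f(x)(b))\big)$.
   Context: $\mathrm{st}$ denotes the canonical strength of a functor $S$ on $\mathbf{Sets}$: $\mathrm{st}\colon S(Y^Z)\to S(Y)^Z$, $\mathrm{st}(u)(z)=S(\mathrm{ev}_z)(u)$, with $\mathrm{ev}_z(g)=g(z)$. $A^*$ is the set of finite words over $A$, $\varepsilon$ the empty word; $1=\{\ast\}$. $t^X\colon T(\Omega)^X\to\Omega^X$ is postcomposition with $t$. The map $\kappa$ is an Eilenberg-Moore law $TB\Rightarrow BT$, $(\Omega^{A^*},\zeta)$ is a final $B$-coalgebra, and the maps $\mathsf{em}_c$, $\mathsf{log}_c$ described exist and are unique. *)

theory Defs
  imports Main "HOL-Library.FuncSet"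
begin

section \<open>The category of sets\<close>

text \<open>
  HOL cannot quantify over type constructors, and a monad on \<open>Sets\<close> acts on all sets at once,
  including the iterated powers and products of sets. Sets are therefore the elements of a type
  carrying a second-order model of ZFC. The axioms are those of Paulson's theory
  \<^emph>\<open>ZFC in HOL\<close> (extensionality, separation, union, power set, replacement, infinity,
  foundation; choice is inherited from HOL), stated as a type class instead of as global axioms.
  HOL itself cannot construct an instance, since such a type is a model of HOL.
\<close>

class zfc_universe =
  fixes elts :: "'a \<Rightarrow> 'a set"
  assumes elts_ext: "elts x = elts y \<Longrightarrow> x = y"
    and elts_down: "Y \<subseteq> elts x \<Longrightarrow> Y \<in> range elts"
    and elts_Union: "X \<in> range elts \<Longrightarrow> \<Union> (elts ` X) \<in> range elts"
    and elts_Pow: "X \<in> range elts \<Longrightarrow> inv elts ` Pow X \<in> range elts"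
    and elts_replacement: "X \<in> range elts \<Longrightarrow> f ` X \<in> range elts"
    and elts_infinity: "range (g :: nat \<Rightarrow> 'a) \<in> range elts"
    and elts_foundation: "wf {(x, y). x \<in> elts y}"

definition vset :: "'v::zfc_universe set \<Rightarrow> 'v"
  where "vset S = inv elts S"

text \<open>Morphisms are HOL functions that are \<^const>\<open>undefined\<close> outside their domain, so that
  equality of morphisms is equality of HOL functions.\<close>

definition vhom :: "'v::zfc_universe \<Rightarrow> 'v \<Rightarrow> ('v \<Rightarrow> 'v) set"
  where "vhom X Y = elts X \<rightarrow>\<^sub>E elts Y"

definition vid :: "'v::zfc_universe \<Rightarrow> 'v \<Rightarrow> 'v"
  where "vid X = (\<lambda>x\<in>elts X. x)"

text \<open>\<open>vcomp X g f\<close> is \<open>g \<circ> f\<close> for \<open>f\<close> with domain \<open>X\<close>.\<close>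

abbreviation vcomp :: "'v::zfc_universe \<Rightarrow> ('v \<Rightarrow> 'v) \<Rightarrow> ('v \<Rightarrow> 'v) \<Rightarrow> 'v \<Rightarrow> 'v"
  where "vcomp X g f \<equiv> compose (elts X) g f"

subsection \<open>Products, coproducts, powers and words\<close>

definition vpair :: "'v::zfc_universe \<Rightarrow> 'v \<Rightarrow> 'v"
  where "vpair x y = vset {vset {x}, vset {x, y}}"

definition vfst :: "'v::zfc_universe \<Rightarrow> 'v"
  where "vfst p = (THE x. \<exists>y. p = vpair x y)"

definition vsnd :: "'v::zfc_universe \<Rightarrow> 'v"
  where "vsnd p = (THE y. \<exists>x. p = vpair x y)"

definition vprod :: "'v::zfc_universe \<Rightarrow> 'v \<Rightarrow> 'v"
  where "vprod X Y = vset {vpair x y |x y. x \<in> elts X \<and> y \<in> elts Y}"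

definition vzero :: "'v::zfc_universe"
  where "vzero = vset {}"

definition vone :: "'v::zfc_universe"
  where "vone = vset {vzero}"

definition vinl :: "'v::zfc_universe \<Rightarrow> 'v"
  where "vinl x = vpair vzero x"

definition vinr :: "'v::zfc_universe \<Rightarrow> 'v"
  where "vinr y = vpair vone y"

definition vsum :: "'v::zfc_universe \<Rightarrow> 'v \<Rightarrow> 'v"
  where "vsum X Y = vset (vinl ` elts X \<union> vinr ` elts Y)"

definition vcase :: "('v::zfc_universe \<Rightarrow> 'v) \<Rightarrow> ('v \<Rightarrow> 'v) \<Rightarrow> 'v \<Rightarrow> 'v"
  where "vcase f g s = (if vfst s = vzero then f (vsnd s) else g (vsnd s))"

text \<open>Elements of the power \<open>Y\<^sup>X\<close>, written \<open>vexp Y X\<close>, are graphs of functions.\<close>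

definition vlam :: "'v::zfc_universe \<Rightarrow> ('v \<Rightarrow> 'v) \<Rightarrow> 'v"
  where "vlam X f = vset ((\<lambda>x. vpair x (f x)) ` elts X)"

definition vapp :: "'v::zfc_universe \<Rightarrow> 'v \<Rightarrow> 'v"
  where "vapp g x = (THE y. vpair x y \<in> elts g)"

definition vexp :: "'v::zfc_universe \<Rightarrow> 'v \<Rightarrow> 'v"
  where "vexp Y X = vset (vlam X ` (elts X \<rightarrow> elts Y))"

text \<open>\<open>vstar A\<close> is \<open>A\<^sup>*\<close>; the empty word is \<open>vword []\<close> and \<open>bw\<close> is \<open>vword (b # w)\<close>.\<close>

fun vword :: "'v::zfc_universe list \<Rightarrow> 'v"
  where "vword [] = vzero"
  | "vword (b # w) = vpair b (vword w)"

definition vstar :: "'v::zfc_universe \<Rightarrow> 'v"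
  where "vstar A = vset (vword ` lists (elts A))"

subsection \<open>The set constructions have the intended elements\<close>

lemma elts_vset: "S \<in> range elts \<Longrightarrow> elts (vset S) = S"
  unfolding vset_def by (rule f_inv_into_f)

lemma vset_inject: "S \<in> range elts \<Longrightarrow> S' \<in> range elts \<Longrightarrow> vset S = vset S' \<Longrightarrow> S = S'"
  by (metis elts_vset)

lemma elts_in_range: "elts X \<in> range elts"
  by blast

lemma small_empty: "{} \<in> range elts"
  by (rule elts_down[of _ undefined]) simp

lemma small_insert2: "{x, y} \<in> range (elts :: 'v::zfc_universe \<Rightarrow> 'v set)"
proof -
  have "range (\<lambda>n::nat. if n = 0 then x else y) = {x, y}" by auto
  then show ?thesis using elts_infinity[of "\<lambda>n::nat. if n = 0 then x else y"] by simp
qed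

lemma small_singleton: "{x} \<in> range (elts :: 'v::zfc_universe \<Rightarrow> 'v set)"
  using small_insert2[of x x] by simp

lemma small_UN:
  fixes F :: "'v::zfc_universe \<Rightarrow> 'v set"
  assumes "S \<in> range elts" and "\<And>x. x \<in> S \<Longrightarrow> F x \<in> range elts"
  shows "(\<Union>x\<in>S. F x) \<in> range elts"
proof -
  have "\<Union> (elts ` ((\<lambda>x. vset (F x)) ` S)) = (\<Union>x\<in>S. F x)"
    using assms(2) by (auto simp: elts_vset)
  then show ?thesis
    using elts_Union[OF elts_replacement[OF assms(1)], of "\<lambda>x. vset (F x)"] by simp
qed

lemma small_UN_nat:
  fixes F :: "nat \<Rightarrow> 'v::zfc_universe set"
  assumes "\<And>n. F n \<in> range elts"
  shows "(\<Union>n. F n) \<in> range elts"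
proof -
  have "\<Union> (elts ` range (\<lambda>n. vset (F n))) = (\<Union>n. F n)"
    using assms by (auto simp: elts_vset)
  then show ?thesis
    using elts_Union[OF elts_infinity[of "\<lambda>n. vset (F n)"]] by simp
qed

lemma small_Un:
  fixes S S' :: "'v::zfc_universe set"
  assumes "S \<in> range elts" and "S' \<in> range elts"
  shows "S \<union> S' \<in> range elts"
proof -
  have "(\<Union>n::nat. if n = 0 then S else S') = S \<union> S'"
    by (auto split: if_splits)
  then show ?thesis
    using small_UN_nat[of "\<lambda>n. if n = 0 then S else S'"] assms by simp
qed

lemma elts_vzero: "elts vzero = {}"
  unfolding vzero_def by (rule elts_vset[OF small_empty])

lemma elts_vone: "elts vone = {vzero}"
  unfolding vone_def by (rule elts_vset[OF small_singleton])

lemma vpair_inject: "vpair x y = vpair x' y' \<longleftrightarrow> x = x' \<and> y = y'"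
proof
  assume "vpair x y = vpair x' y'"
  then have "{vset {x}, vset {x, y}} = {vset {x'}, vset {x', y'}}"
    unfolding vpair_def by (rule vset_inject[OF small_insert2 small_insert2])
  then have "{elts (vset {x}), elts (vset {x, y})} = {elts (vset {x'}), elts (vset {x', y'})}"
    by (metis image_empty image_insert)
  then have "{{x}, {x, y}} = {{x'}, {x', y'}}"
    by (simp only: elts_vset[OF small_insert2] elts_vset[OF small_singleton])
  then show "x = x' \<and> y = y'"
    by (simp add: doubleton_eq_iff) blast
qed simp

lemma vpair_neq_vzero: "vpair x y \<noteq> vzero"
proof
  assume "vpair x y = vzero"
  then have "elts (vpair x y) = {}" by (simp add: elts_vzero)
  then show False unfolding vpair_def by (simp add: elts_vset[OF small_insert2])
qed

lemma vone_neq_vzero: "vone \<noteq> vzero"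
  using elts_vone elts_vzero by (metis insert_not_empty)

lemma vfst_vpair [simp]: "vfst (vpair x y) = x"
  unfolding vfst_def by (simp add: vpair_inject)

lemma vsnd_vpair [simp]: "vsnd (vpair x y) = y"
  unfolding vsnd_def by (simp add: vpair_inject)

lemma vcase_vinl [simp]: "vcase f g (vinl x) = f x"
  by (simp add: vcase_def vinl_def)

lemma vcase_vinr [simp]: "vcase f g (vinr y) = g y"
  by (simp add: vcase_def vinr_def vone_neq_vzero)

lemma elts_vprod: "elts (vprod X Y) = {vpair x y |x y. x \<in> elts X \<and> y \<in> elts Y}"
proof -
  have "{vpair x y |x y. x \<in> elts X \<and> y \<in> elts Y} = (\<Union>x\<in>elts X. vpair x ` elts Y)"
    by auto
  also have "\<dots> \<in> range elts"
    by (intro small_UN elts_replacement elts_in_range)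
  finally show ?thesis unfolding vprod_def by (rule elts_vset)
qed

lemma elts_vsum: "elts (vsum X Y) = vinl ` elts X \<union> vinr ` elts Y"
  unfolding vsum_def by (intro elts_vset small_Un elts_replacement elts_in_range)

lemma elts_vlam: "elts (vlam X f) = (\<lambda>x. vpair x (f x)) ` elts X"
  unfolding vlam_def by (intro elts_vset elts_replacement elts_in_range)

lemma vapp_vlam [simp]: "x \<in> elts X \<Longrightarrow> vapp (vlam X f) x = f x"
  unfolding vapp_def by (auto simp: elts_vlam vpair_inject)

lemma vlam_cong: "(\<And>x. x \<in> elts X \<Longrightarrow> f x = g x) \<Longrightarrow> vlam X f = vlam X g"
  unfolding vlam_def by (metis (mono_tags, lifting) image_cong)

lemma elts_vexp: "elts (vexp Y X) = vlam X ` (elts X \<rightarrow> elts Y)"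
proof -
  have "vlam X ` (elts X \<rightarrow> elts Y) \<subseteq> inv elts ` Pow (elts (vprod X Y))"
    unfolding vlam_def vset_def by (auto simp: elts_vprod)
  moreover have "inv elts ` Pow (elts (vprod X Y)) \<in> range elts"
    by (intro elts_Pow elts_in_range)
  ultimately have "vlam X ` (elts X \<rightarrow> elts Y) \<in> range elts"
    by (metis (no_types, lifting) elts_down imageE)
  then show ?thesis unfolding vexp_def by (rule elts_vset)
qed

lemma vapp_in: "g \<in> elts (vexp Y X) \<Longrightarrow> x \<in> elts X \<Longrightarrow> vapp g x \<in> elts Y"
  by (auto simp: elts_vexp)

lemma vexp_eqI:
  assumes "g \<in> elts (vexp Y X)" and "h \<in> elts (vexp Y' X)"
    and "\<And>x. x \<in> elts X \<Longrightarrow> vapp g x = vapp h x"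
  shows "g = h"
  using assms by (auto simp: elts_vexp intro!: vlam_cong)

lemma vword_inject: "vword v = vword w \<longleftrightarrow> v = w"
proof (induction v arbitrary: w)
  case Nil
  then show ?case by (cases w) (auto simp: vpair_neq_vzero vpair_neq_vzero[symmetric])
next
  case (Cons b v)
  then show ?case by (cases w) (auto simp: vpair_neq_vzero vpair_inject)
qed

lemma elts_vstar: "elts (vstar A) = vword ` lists (elts A)"
proof -
  let ?L = "\<lambda>n. vword ` {w \<in> lists (elts A). length w = n}"
  have L: "?L n \<in> range elts" for n
  proof (induction n)
    case 0
    have "{w \<in> lists (elts A). length w = 0} = {[]}" by auto
    then show ?case by (simp add: small_singleton)
  next
    case (Suc n)
    have "?L (Suc n) = (\<Union>b\<in>elts A. vpair b ` ?L n)"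
    proof (intro set_eqI iffI)
      fix u assume "u \<in> ?L (Suc n)"
      then obtain v where v: "u = vword v" "v \<in> lists (elts A)" "length v = Suc n" by blast
      then obtain b w where "v = b # w" by (cases v) auto
      with v have "u = vword (b # w)" "b \<in> elts A" "w \<in> lists (elts A)" "length w = n" by auto
      then show "u \<in> (\<Union>b\<in>elts A. vpair b ` ?L n)" by auto
    next
      fix u assume "u \<in> (\<Union>b\<in>elts A. vpair b ` ?L n)"
      then obtain b w where "u = vword (b # w)" "b \<in> elts A" "w \<in> lists (elts A)" "length w = n"
        by auto
      then show "u \<in> ?L (Suc n)" by (intro image_eqI[of _ _ "b # w"]) auto
    qed
    then show ?case
      using small_UN[of "elts A" "\<lambda>b. vpair b ` ?L n"] elts_replacement[OF Suc] elts_in_range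
      by simp
  qed
  have "vword ` lists (elts A) = (\<Union>n. ?L n)" by auto
  also have "\<dots> \<in> range elts" by (rule small_UN_nat[OF L])
  finally show ?thesis unfolding vstar_def by (rule elts_vset)
qed

subsection \<open>Maps between products and powers\<close>

definition vproj1 :: "'v::zfc_universe \<Rightarrow> 'v \<Rightarrow> 'v \<Rightarrow> 'v"
  where "vproj1 X Y = (\<lambda>p\<in>elts (vprod X Y). vfst p)"

definition vproj2 :: "'v::zfc_universe \<Rightarrow> 'v \<Rightarrow> 'v \<Rightarrow> 'v"
  where "vproj2 X Y = (\<lambda>p\<in>elts (vprod X Y). vsnd p)"

text \<open>\<open>\<langle>f, g\<rangle>\<close> for \<open>f\<close> and \<open>g\<close> with domain \<open>Z\<close>\<close>

definition vtuple :: "'v::zfc_universe \<Rightarrow> ('v \<Rightarrow> 'v) \<Rightarrow> ('v \<Rightarrow> 'v) \<Rightarrow> 'v \<Rightarrow> 'v"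
  where "vtuple Z f g = (\<lambda>z\<in>elts Z. vpair (f z) (g z))"

text \<open>\<open>f \<times> g\<close> for \<open>f\<close> with domain \<open>X\<close> and \<open>g\<close> with domain \<open>Y\<close>\<close>

definition vprod_map :: "'v::zfc_universe \<Rightarrow> 'v \<Rightarrow> ('v \<Rightarrow> 'v) \<Rightarrow> ('v \<Rightarrow> 'v) \<Rightarrow> 'v \<Rightarrow> 'v"
  where "vprod_map X Y f g = (\<lambda>p\<in>elts (vprod X Y). vpair (f (vfst p)) (g (vsnd p)))"

text \<open>\<open>h\<^sup>Z\<close>, postcomposition with \<open>h\<close>, for \<open>h\<close> with domain \<open>Y\<close>\<close>

definition vexp_map :: "'v::zfc_universe \<Rightarrow> 'v \<Rightarrow> ('v \<Rightarrow> 'v) \<Rightarrow> 'v \<Rightarrow> 'v"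
  where "vexp_map Y Z h = (\<lambda>g\<in>elts (vexp Y Z). vlam Z (\<lambda>z. h (vapp g z)))"

definition vev :: "'v::zfc_universe \<Rightarrow> 'v \<Rightarrow> 'v \<Rightarrow> 'v \<Rightarrow> 'v"
  where "vev Y Z z = (\<lambda>g\<in>elts (vexp Y Z). vapp g z)"

section \<open>Monads and Eilenberg-Moore algebras\<close>

text \<open>A functor on \<open>Sets\<close> is given by \<open>T\<close> on objects and \<open>Tm X Y\<close> on morphisms from \<open>X\<close> to \<open>Y\<close>.\<close>

locale sets_functor =
  fixes T :: "'v::zfc_universe \<Rightarrow> 'v"
    and Tm :: "'v \<Rightarrow> 'v \<Rightarrow> ('v \<Rightarrow> 'v) \<Rightarrow> 'v \<Rightarrow> 'v"
  assumes map_hom: "f \<in> vhom X Y \<Longrightarrow> Tm X Y f \<in> vhom (T X) (T Y)"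
    and map_id: "Tm X X (vid X) = vid (T X)"
    and map_comp: "f \<in> vhom X Y \<Longrightarrow> g \<in> vhom Y Z \<Longrightarrow>
      Tm X Z (vcomp X g f) = vcomp (T X) (Tm Y Z g) (Tm X Y f)"

locale sets_monad = sets_functor T Tm
  for T :: "'v::zfc_universe \<Rightarrow> 'v"
    and Tm :: "'v \<Rightarrow> 'v \<Rightarrow> ('v \<Rightarrow> 'v) \<Rightarrow> 'v \<Rightarrow> 'v" +
  fixes eta mu :: "'v \<Rightarrow> 'v \<Rightarrow> 'v"
  assumes unit_hom: "eta X \<in> vhom X (T X)"
    and unit_natural: "f \<in> vhom X Y \<Longrightarrow>
      vcomp X (eta Y) f = vcomp X (Tm X Y f) (eta X)"
    and mult_hom: "mu X \<in> vhom (T (T X)) (T X)"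
    and mult_natural: "f \<in> vhom X Y \<Longrightarrow>
      vcomp (T (T X)) (mu Y) (Tm (T X) (T Y) (Tm X Y f)) = vcomp (T (T X)) (Tm X Y f) (mu X)"
    and mult_unit: "vcomp (T X) (mu X) (eta (T X)) = vid (T X)"
    and mult_map_unit: "vcomp (T X) (mu X) (Tm X (T X) (eta X)) = vid (T X)"
    and mult_assoc: "vcomp (T (T (T X))) (mu X) (mu (T X)) =
      vcomp (T (T (T X))) (mu X) (Tm (T (T X)) (T X) (mu X))"

locale em_algebra = sets_monad T Tm eta mu
  for T :: "'v::zfc_universe \<Rightarrow> 'v"
    and Tm :: "'v \<Rightarrow> 'v \<Rightarrow> ('v \<Rightarrow> 'v) \<Rightarrow> 'v \<Rightarrow> 'v"
    and eta mu :: "'v \<Rightarrow> 'v \<Rightarrow> 'v" +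
  fixes \<Omega> :: 'v and t :: "'v \<Rightarrow> 'v"
  assumes alg_hom: "t \<in> vhom (T \<Omega>) \<Omega>"
    and alg_unit: "vcomp \<Omega> t (eta \<Omega>) = vid \<Omega>"
    and alg_mult: "vcomp (T (T \<Omega>)) t (mu \<Omega>) = vcomp (T (T \<Omega>)) t (Tm (T \<Omega>) \<Omega> t)"

section \<open>The functor, the laws and the two semantics\<close>

text \<open>\<open>strength T Tm Y Z\<close> is \<open>st : T(Y\<^sup>Z) \<rightarrow> T(Y)\<^sup>Z\<close>.\<close>

definition strength ::
  "('v::zfc_universe \<Rightarrow> 'v) \<Rightarrow> ('v \<Rightarrow> 'v \<Rightarrow> ('v \<Rightarrow> 'v) \<Rightarrow> 'v \<Rightarrow> 'v) \<Rightarrow> 'v \<Rightarrow> 'v \<Rightarrow> 'v \<Rightarrow> 'v"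
  where "strength T Tm Y Z =
    (\<lambda>u\<in>elts (T (vexp Y Z)). vlam Z (\<lambda>z. Tm (vexp Y Z) Y (vev Y Z z) u))"

definition B_obj :: "'v::zfc_universe \<Rightarrow> 'v \<Rightarrow> 'v \<Rightarrow> 'v"
  where "B_obj \<Omega> A X = vprod \<Omega> (vexp X A)"

text \<open>\<open>B_map \<Omega> A X h\<close> is \<open>B(h)\<close> for \<open>h\<close> with domain \<open>X\<close>.\<close>

definition B_map :: "'v::zfc_universe \<Rightarrow> 'v \<Rightarrow> 'v \<Rightarrow> ('v \<Rightarrow> 'v) \<Rightarrow> 'v \<Rightarrow> 'v"
  where "B_map \<Omega> A X h = vprod_map \<Omega> (vexp X A) (vid \<Omega>) (vexp_map X A h)"

definition kappa ::
  "('v::zfc_universe \<Rightarrow> 'v) \<Rightarrow> ('v \<Rightarrow> 'v \<Rightarrow> ('v \<Rightarrow> 'v) \<Rightarrow> 'v \<Rightarrow> 'v) \<Rightarrow> 'v \<Rightarrow> ('v \<Rightarrow> 'v) \<Rightarrow> 'v \<Rightarrow>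
    'v \<Rightarrow> 'v \<Rightarrow> 'v"
  where "kappa T Tm \<Omega> t A X =
    vcomp (T (B_obj \<Omega> A X))
      (vprod_map (T \<Omega>) (T (vexp X A)) t (strength T Tm X A))
      (vtuple (T (B_obj \<Omega> A X))
        (Tm (B_obj \<Omega> A X) \<Omega> (vproj1 \<Omega> (vexp X A)))
        (Tm (B_obj \<Omega> A X) (vexp X A) (vproj2 \<Omega> (vexp X A))))"

definition tau ::
  "('v::zfc_universe \<Rightarrow> 'v) \<Rightarrow> ('v \<Rightarrow> 'v \<Rightarrow> ('v \<Rightarrow> 'v) \<Rightarrow> 'v \<Rightarrow> 'v) \<Rightarrow> 'v \<Rightarrow> ('v \<Rightarrow> 'v) \<Rightarrow> 'v \<Rightarrow> 'v \<Rightarrow> 'v"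
  where "tau T Tm \<Omega> t X =
    vcomp (T (vexp \<Omega> X)) (vexp_map (T \<Omega>) X t) (strength T Tm \<Omega> X)"

definition L_obj :: "'v::zfc_universe \<Rightarrow> 'v \<Rightarrow> 'v"
  where "L_obj A X = vsum (vprod A X) vone"

definition delta :: "'v::zfc_universe \<Rightarrow> 'v \<Rightarrow> 'v \<Rightarrow> 'v \<Rightarrow> 'v"
  where "delta \<Omega> A X = (\<lambda>p\<in>elts (B_obj \<Omega> A (vexp \<Omega> X)).
    vlam (L_obj A X)
      (vcase (\<lambda>q. vapp (vapp (vsnd p) (vfst q)) (vsnd q)) (\<lambda>_. vfst p)))"

definition zeta :: "'v::zfc_universe \<Rightarrow> 'v \<Rightarrow> 'v \<Rightarrow> 'v"
  where "zeta \<Omega> A = (\<lambda>\<phi>\<in>elts (vexp \<Omega> (vstar A)).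
    vpair (vapp \<phi> (vword [])) (vlam A (\<lambda>b. vlam (vstar A) (\<lambda>w. vapp \<phi> (vpair b w)))))"

definition zeta_inv :: "'v::zfc_universe \<Rightarrow> 'v \<Rightarrow> 'v \<Rightarrow> 'v"
  where "zeta_inv \<Omega> A = (\<lambda>p\<in>elts (B_obj \<Omega> A (vexp \<Omega> (vstar A))).
    inv_into (elts (vexp \<Omega> (vstar A))) (zeta \<Omega> A) p)"

definition is_em_semantics ::
  "('v::zfc_universe \<Rightarrow> 'v) \<Rightarrow> ('v \<Rightarrow> 'v \<Rightarrow> ('v \<Rightarrow> 'v) \<Rightarrow> 'v \<Rightarrow> 'v) \<Rightarrow> 'v \<Rightarrow> ('v \<Rightarrow> 'v) \<Rightarrow> 'v \<Rightarrow>
    'v \<Rightarrow> ('v \<Rightarrow> 'v) \<Rightarrow> ('v \<Rightarrow> 'v) \<Rightarrow> bool"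
  where "is_em_semantics T Tm \<Omega> t A X c h \<longleftrightarrow>
    (let Z = vexp \<Omega> (vstar A) in
      h \<in> vhom X Z \<and>
      h = vcomp X (zeta_inv \<Omega> A)
            (vcomp X (B_map \<Omega> A (T Z) (tau T Tm \<Omega> t (vstar A)))
              (vcomp X (B_map \<Omega> A (T X) (Tm X Z h)) c)))"

definition em_semantics ::
  "('v::zfc_universe \<Rightarrow> 'v) \<Rightarrow> ('v \<Rightarrow> 'v \<Rightarrow> ('v \<Rightarrow> 'v) \<Rightarrow> 'v \<Rightarrow> 'v) \<Rightarrow> 'v \<Rightarrow> ('v \<Rightarrow> 'v) \<Rightarrow> 'v \<Rightarrow>
    'v \<Rightarrow> ('v \<Rightarrow> 'v) \<Rightarrow> 'v \<Rightarrow> 'v"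
  where "em_semantics T Tm \<Omega> t A X c = (THE h. is_em_semantics T Tm \<Omega> t A X c h)"

definition is_log_semantics ::
  "('v::zfc_universe \<Rightarrow> 'v) \<Rightarrow> ('v \<Rightarrow> 'v \<Rightarrow> ('v \<Rightarrow> 'v) \<Rightarrow> 'v \<Rightarrow> 'v) \<Rightarrow> 'v \<Rightarrow> ('v \<Rightarrow> 'v) \<Rightarrow> 'v \<Rightarrow>
    'v \<Rightarrow> ('v \<Rightarrow> 'v) \<Rightarrow> ('v \<Rightarrow> 'v) \<Rightarrow> ('v \<Rightarrow> 'v) \<Rightarrow> bool"
  where "is_log_semantics T Tm \<Omega> t A X out f l \<longleftrightarrow>
    l \<in> vhom X (vexp \<Omega> (vstar A)) \<and>
    (\<forall>x\<in>elts X. vapp (l x) (vword []) = out x) \<and>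
    (\<forall>x\<in>elts X. \<forall>b\<in>elts A. \<forall>w\<in>elts (vstar A).
      vapp (l x) (vpair b w) =
        t (Tm X \<Omega> (vcomp X (vev \<Omega> (vstar A) w) l) (vapp (f x) b)))"

definition log_semantics ::
  "('v::zfc_universe \<Rightarrow> 'v) \<Rightarrow> ('v \<Rightarrow> 'v \<Rightarrow> ('v \<Rightarrow> 'v) \<Rightarrow> 'v \<Rightarrow> 'v) \<Rightarrow> 'v \<Rightarrow> ('v \<Rightarrow> 'v) \<Rightarrow> 'v \<Rightarrow>
    'v \<Rightarrow> ('v \<Rightarrow> 'v) \<Rightarrow> ('v \<Rightarrow> 'v) \<Rightarrow> 'v \<Rightarrow> 'v"
  where "log_semantics T Tm \<Omega> t A X out f = (THE l. is_log_semantics T Tm \<Omega> t A X out f l)"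

end

(* Both semantics solve the same system of equations: by functoriality, evaluating the
   Eilenberg-Moore equation at a word w turns the algebra on the final coalgebra into
   t composed with T (ev_w o h), which is the defining clause of the logical semantics. That system
   determines its solution by recursion on words, so the two semantics agree and the comparison
   bijection is the identity. *)

theory Submission
  imports Defs
begin

section \<open>Elements of products, powers and words\<close>

lemma vpair_in_vprod [simp]: "vpair x y \<in> elts (vprod X Y) \<longleftrightarrow> x \<in> elts X \<and> y \<in> elts Y"
  by (auto simp: elts_vprod vpair_inject)

lemma vprodE:
  assumes "p \<in> elts (vprod X Y)"
  obtains x y where "p = vpair x y" "x \<in> elts X" "y \<in> elts Y"
  using assms by (auto simp: elts_vprod)

lemma vlam_in: "(\<And>x. x \<in> elts X \<Longrightarrow> f x \<in> elts Y) \<Longrightarrow> vlam X f \<in> elts (vexp Y X)"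
  by (auto simp: elts_vexp)

lemma vlam_eq_iff: "vlam X f = vlam X g \<longleftrightarrow> (\<forall>x\<in>elts X. f x = g x)"
  by (metis vapp_vlam vlam_cong)

lemma vlam_vapp: "g \<in> elts (vexp Y X) \<Longrightarrow> vlam X (vapp g) = g"
  by (auto simp: elts_vexp intro!: vlam_cong)

lemma vhom_in: "f \<in> vhom X Y \<Longrightarrow> x \<in> elts X \<Longrightarrow> f x \<in> elts Y"
  by (auto simp: vhom_def)

lemma vhomI: "(\<And>x. x \<in> elts X \<Longrightarrow> f x \<in> elts Y) \<Longrightarrow> restrict f (elts X) \<in> vhom X Y"
  by (auto simp: vhom_def)

lemma vhom_eqI:
  "f \<in> vhom X Y \<Longrightarrow> g \<in> vhom X Z \<Longrightarrow> (\<And>x. x \<in> elts X \<Longrightarrow> f x = g x) \<Longrightarrow> f = g"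
  by (auto simp: vhom_def PiE_def intro: extensionalityI)

lemma vcomp_hom: "f \<in> vhom X Y \<Longrightarrow> g \<in> vhom Y Z \<Longrightarrow> vcomp X g f \<in> vhom X Z"
  by (auto simp: vhom_def compose_def)

lemma vid_hom: "vid X \<in> vhom X X"
  by (auto simp: vid_def vhom_def)

lemma vcomp_vid_left: "f \<in> vhom X Y \<Longrightarrow> vcomp X (vid Y) f = f"
  by (rule vhom_eqI[OF vcomp_hom[OF _ vid_hom]])
    (auto simp: vid_def compose_eq dest: vhom_in)

lemma vev_hom: "z \<in> elts Z \<Longrightarrow> vev Y Z z \<in> vhom (vexp Y Z) Y"
  unfolding vev_def by (rule vhomI) (rule vapp_in)

lemma vproj1_hom: "vproj1 X Y \<in> vhom (vprod X Y) X"
  unfolding vproj1_def by (rule vhomI) (auto elim: vprodE)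

lemma vproj2_hom: "vproj2 X Y \<in> vhom (vprod X Y) Y"
  unfolding vproj2_def by (rule vhomI) (auto elim: vprodE)

lemma vzero_in_vstar: "vzero \<in> elts (vstar A)"
  unfolding elts_vstar by (rule image_eqI[of _ _ "[]"]) auto

lemma vpair_in_vstar:
  assumes "b \<in> elts A" "w \<in> elts (vstar A)"
  shows "vpair b w \<in> elts (vstar A)"
proof -
  from assms(2) obtain v where "w = vword v" "v \<in> lists (elts A)"
    by (auto simp: elts_vstar)
  with assms(1) show ?thesis
    unfolding elts_vstar by (intro image_eqI[of _ _ "b # v"]) auto
qed

text \<open>Splits elements of the set of words without exposing the underlying lists. Together with
  \<open>vpair_neq_vzero\<close> it makes the test \<open>u = vzero\<close> decide whether a word is
  empty.\<close>

lemma vstar_cases: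
  assumes "u \<in> elts (vstar A)"
  obtains "u = vzero"
  | b w where "u = vpair b w" "b \<in> elts A" "w \<in> elts (vstar A)"
proof -
  from assms obtain v where v: "u = vword v" "v \<in> lists (elts A)"
    by (auto simp: elts_vstar)
  show thesis
  proof (cases v)
    case Nil
    with v that(1) show thesis by simp
  next
    case (Cons b w)
    with v that(2)[of b "vword w"] show thesis by (auto simp: elts_vstar)
  qed
qed

lemma L_obj_cases:
  assumes "s \<in> elts (L_obj A X)"
  obtains a x where "s = vinl (vpair a x)" "a \<in> elts A" "x \<in> elts X"
  | "s = vinr vzero"
  using assms by (auto simp: L_obj_def elts_vsum elts_vone elts_vprod)

section \<open>The final coalgebra\<close>

text \<open>A function on words amounts to its value at the empty word together with one function on
  tails for each first letter. Since \<open>zeta_inv\<close> is built from \<open>inv_into\<close>,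
  this bijectivity is what makes it a two-sided inverse.\<close>

lemma zeta_bij:
  "bij_betw (zeta \<Omega> A) (elts (vexp \<Omega> (vstar A))) (elts (B_obj \<Omega> A (vexp \<Omega> (vstar A))))"
proof (rule bij_betw_imageI)
  let ?Z = "vexp \<Omega> (vstar A)"
  show "inj_on (zeta \<Omega> A) (elts ?Z)"
  proof (rule inj_onI)
    fix \<phi> \<psi> assume \<phi>: "\<phi> \<in> elts ?Z" and \<psi>: "\<psi> \<in> elts ?Z" and "zeta \<Omega> A \<phi> = zeta \<Omega> A \<psi>"
    then have "vapp \<phi> vzero = vapp \<psi> vzero"
      and "\<forall>b\<in>elts A. \<forall>w\<in>elts (vstar A). vapp \<phi> (vpair b w) = vapp \<psi> (vpair b w)"
      by (auto simp: zeta_def vpair_inject vlam_eq_iff)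
    then show "\<phi> = \<psi>"
      by (intro vexp_eqI[OF \<phi> \<psi>]) (erule vstar_cases; simp)
  qed
  show "zeta \<Omega> A ` elts ?Z = elts (B_obj \<Omega> A ?Z)"
  proof (intro equalityI subsetI)
    fix p assume "p \<in> zeta \<Omega> A ` elts ?Z"
    then show "p \<in> elts (B_obj \<Omega> A ?Z)"
      by (auto simp: zeta_def B_obj_def intro!: vlam_in vapp_in vzero_in_vstar vpair_in_vstar)
  next
    fix p assume "p \<in> elts (B_obj \<Omega> A ?Z)"
    then obtain \<omega> g where p: "p = vpair \<omega> g" "\<omega> \<in> elts \<Omega>" and g: "g \<in> elts (vexp ?Z A)"
      unfolding B_obj_def by (rule vprodE)
    \<comment> \<open>The preimage of \<open>p\<close> is forced: \<open>\<omega>\<close> at the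
      empty word, and the value of \<open>g\<close> at first letter and tail otherwise.\<close>
    define \<phi> where "\<phi> = vlam (vstar A)
      (\<lambda>u. if u = vzero then \<omega> else vapp (vapp g (vfst u)) (vsnd u))"
    have \<phi>: "\<phi> \<in> elts ?Z"
      unfolding \<phi>_def using p(2) g
      by (intro vlam_in) (erule vstar_cases; auto simp: vpair_neq_vzero intro!: vapp_in)
    have "vlam A (\<lambda>b. vlam (vstar A) (\<lambda>w. vapp \<phi> (vpair b w)))
        = vlam A (\<lambda>b. vlam (vstar A) (vapp (vapp g b)))"
      by (intro vlam_cong) (simp add: \<phi>_def vpair_in_vstar vpair_neq_vzero)
    also have "\<dots> = vlam A (vapp g)"
      by (intro vlam_cong vlam_vapp) (rule vapp_in[OF g])
    also have "\<dots> = g"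
      by (rule vlam_vapp[OF g])
    finally have "zeta \<Omega> A \<phi> = p"
      \<comment> \<open>The first call keeps \<open>\<phi>\<close> folded, so that the tail
        component matches the chain above; only then is \<open>\<phi>\<close> unfolded, for its
        value at the empty word.\<close>
      using \<phi> by (simp add: zeta_def p(1)) (simp add: \<phi>_def vzero_in_vstar)
    with \<phi> show "p \<in> zeta \<Omega> A ` elts ?Z" by blast
  qed
qed

text \<open>Trades the inverse for \<open>zeta\<close> itself, whose components can be read off word
  by word.\<close>

lemma eq_zeta_inv_iff:
  assumes "\<phi> \<in> elts (vexp \<Omega> (vstar A))" "p \<in> elts (B_obj \<Omega> A (vexp \<Omega> (vstar A)))"
  shows "\<phi> = zeta_inv \<Omega> A p \<longleftrightarrow> zeta \<Omega> A \<phi> = p"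
  using assms bij_betw_inv_into_left[OF zeta_bij assms(1)]
    bij_betw_inv_into_right[OF zeta_bij assms(2)]
  by (auto simp: zeta_inv_def)

lemma zeta_inv_hom: "zeta_inv \<Omega> A \<in> vhom (B_obj \<Omega> A (vexp \<Omega> (vstar A))) (vexp \<Omega> (vstar A))"
  unfolding zeta_inv_def
  by (rule vhomI) (metis bij_betw_imp_surj_on inv_into_into zeta_bij)

section \<open>Strength and the predicate lifting\<close>

lemma delta_vpair:
  assumes "\<omega> \<in> elts \<Omega>" "g \<in> elts (vexp (vexp \<Omega> X) A)"
  shows "delta \<Omega> A X (vpair \<omega> g) =
    vlam (L_obj A X) (vcase (\<lambda>q. vapp (vapp g (vfst q)) (vsnd q)) (\<lambda>_. \<omega>))"
  using assms by (simp add: delta_def B_obj_def)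

lemma delta_hom: "delta \<Omega> A X \<in> vhom (B_obj \<Omega> A (vexp \<Omega> X)) (vexp \<Omega> (L_obj A X))"
  unfolding delta_def
  by (rule vhomI, rule vlam_in)
    (auto simp: B_obj_def elim!: vprodE L_obj_cases intro!: vapp_in)

lemma B_map_hom:
  assumes "h \<in> vhom X Y"
  shows "B_map \<Omega> A X h \<in> vhom (B_obj \<Omega> A X) (B_obj \<Omega> A Y)"
  unfolding B_map_def vprod_map_def B_obj_def
  by (rule vhomI)
    (auto simp: vid_def vexp_map_def elim!: vprodE
      intro!: vlam_in vhom_in[OF assms] vapp_in)

lemma B_map_vpair:
  "\<omega> \<in> elts \<Omega> \<Longrightarrow> g \<in> elts (vexp X A) \<Longrightarrow>
    B_map \<Omega> A X h (vpair \<omega> g) = vpair \<omega> (vlam A (\<lambda>b. h (vapp g b)))"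
  by (simp add: B_map_def vprod_map_def vid_def vexp_map_def)

section \<open>Pointwise formulas for the strength, \<open>tau\<close> and
  \<open>kappa\<close>\<close>

context sets_functor
begin

lemma map_in: "f \<in> vhom X Y \<Longrightarrow> u \<in> elts (T X) \<Longrightarrow> Tm X Y f u \<in> elts (T Y)"
  by (rule vhom_in[OF map_hom])

lemma map_map:
  "f \<in> vhom X Y \<Longrightarrow> g \<in> vhom Y Z \<Longrightarrow> u \<in> elts (T X) \<Longrightarrow>
    Tm Y Z g (Tm X Y f u) = Tm X Z (vcomp X g f) u"
  by (simp add: map_comp compose_eq)

lemma strength_apply:
  "u \<in> elts (T (vexp Y Z)) \<Longrightarrow> strength T Tm Y Z u = vlam Z (\<lambda>z. Tm (vexp Y Z) Y (vev Y Z z) u)"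
  by (simp add: strength_def)

lemma strength_in: "u \<in> elts (T (vexp Y Z)) \<Longrightarrow> strength T Tm Y Z u \<in> elts (vexp (T Y) Z)"
  by (auto simp: strength_apply intro!: vlam_in map_in vev_hom)

text \<open>The strength is a table of the values T(ev_x)(u), and postcomposition acts entrywise.
  This form reduces statements about \<open>tau\<close> to functoriality of T at evaluation
  maps.\<close>

lemma tau_apply:
  assumes "u \<in> elts (T (vexp \<Omega> X))"
  shows "tau T Tm \<Omega> t X u = vlam X (\<lambda>x. t (Tm (vexp \<Omega> X) \<Omega> (vev \<Omega> X x) u))"
proof -
  have "tau T Tm \<Omega> t X u = vlam X (\<lambda>x. t (vapp (strength T Tm \<Omega> X u) x))"
    using assms strength_in[OF assms] by (simp add: tau_def compose_eq vexp_map_def)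
  also have "\<dots> = vlam X (\<lambda>x. t (Tm (vexp \<Omega> X) \<Omega> (vev \<Omega> X x) u))"
    by (rule vlam_cong) (simp add: strength_apply[OF assms])
  finally show ?thesis .
qed

lemma tau_hom:
  assumes "t \<in> vhom (T \<Omega>) \<Omega>"
  shows "tau T Tm \<Omega> t X \<in> vhom (T (vexp \<Omega> X)) (vexp \<Omega> X)"
proof -
  \<comment> \<open>A composite is already \<open>undefined\<close> off its domain, so restricting
    changes nothing and brings \<open>vhomI\<close> into play.\<close>
  have "tau T Tm \<Omega> t X = restrict (tau T Tm \<Omega> t X) (elts (T (vexp \<Omega> X)))"
    by (auto simp: tau_def compose_def)
  also have "\<dots> \<in> vhom (T (vexp \<Omega> X)) (vexp \<Omega> X)"
    by (rule vhomI) (auto simp: tau_apply intro!: vlam_in vhom_in[OF assms] map_in vev_hom)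
  finally show ?thesis .
qed

lemma kappa_apply:
  assumes "u \<in> elts (T (B_obj \<Omega> A X))"
  shows "kappa T Tm \<Omega> t A X u =
    vpair (t (Tm (B_obj \<Omega> A X) \<Omega> (vproj1 \<Omega> (vexp X A)) u))
      (strength T Tm X A (Tm (B_obj \<Omega> A X) (vexp X A) (vproj2 \<Omega> (vexp X A)) u))"
  using assms
  by (simp add: kappa_def compose_eq vtuple_def vprod_map_def B_obj_def
      map_in[OF vproj1_hom] map_in[OF vproj2_hom])

text \<open>At each index s of A x X + 1, both sides are t after T of a single map from
  B(\<Omega>^X) to \<Omega>. On the right this map is ev_s after \<open>delta\<close>; on the left
  it is the first projection, or the second projection evaluated at a and then at x. These maps
  coincide.\<close>

lemma delta_tau_kappa:
  assumes t: "t \<in> vhom (T \<Omega>) \<Omega>"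
  shows "vcomp (T (B_obj \<Omega> A (vexp \<Omega> X)))
        (vcomp (B_obj \<Omega> A (T (vexp \<Omega> X)))
          (delta \<Omega> A X)
          (vprod_map \<Omega> (vexp (T (vexp \<Omega> X)) A)
            (vid \<Omega>) (vexp_map (T (vexp \<Omega> X)) A (tau T Tm \<Omega> t X))))
        (kappa T Tm \<Omega> t A (vexp \<Omega> X)) =
      vcomp (T (B_obj \<Omega> A (vexp \<Omega> X)))
        (tau T Tm \<Omega> t (L_obj A X))
        (Tm (B_obj \<Omega> A (vexp \<Omega> X)) (vexp \<Omega> (L_obj A X)) (delta \<Omega> A X))"
    (is "vcomp (T ?B) (vcomp ?BT ?\<delta> (vprod_map _ _ _ ?\<tau>A)) ?\<kappa> = vcomp (T ?B) ?\<tau> ?T\<delta>")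
proof -
  let ?P = "vexp \<Omega> X"
  let ?L = "L_obj A X"
  \<comment> \<open>The middle factor is written as \<open>B_map\<close>, so that
    \<open>B_map_vpair\<close> applies; unfolding \<open>B_map_def\<close> at the end restores the
    original form.\<close>
  have "?\<delta> (B_map \<Omega> A (T ?P) (tau T Tm \<Omega> t X) (?\<kappa> u)) = ?\<tau> (?T\<delta> u)"
    if u: "u \<in> elts (T ?B)" for u
  proof -
    have p1: "vproj1 \<Omega> (vexp ?P A) \<in> vhom ?B \<Omega>" and p2: "vproj2 \<Omega> (vexp ?P A) \<in> vhom ?B (vexp ?P A)"
      unfolding B_obj_def by (rule vproj1_hom vproj2_hom)+
    \<comment> \<open>\<open>\<omega>\<close> and \<open>g\<close> are the components obtained after
      applying \<open>kappa\<close> and then \<open>tau\<close> under B; \<open>v\<close> is the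
      argument that \<open>kappa\<close> passes to the strength.\<close>
    define \<omega> where "\<omega> = t (Tm ?B \<Omega> (vproj1 \<Omega> (vexp ?P A)) u)"
    define v where "v = Tm ?B (vexp ?P A) (vproj2 \<Omega> (vexp ?P A)) u"
    define g where "g = vlam A (\<lambda>a. tau T Tm \<Omega> t X (vapp (strength T Tm ?P A v) a))"
    have \<omega>: "\<omega> \<in> elts \<Omega>"
      unfolding \<omega>_def by (intro vhom_in[OF t] map_in[OF p1] u)
    have v: "v \<in> elts (T (vexp ?P A))"
      unfolding v_def by (intro map_in[OF p2] u)
    have g: "g \<in> elts (vexp ?P A)"
      unfolding g_def by (intro vlam_in vhom_in[OF tau_hom[OF t]]) (rule vapp_in[OF strength_in[OF v]])
    have T\<delta>: "?T\<delta> u \<in> elts (T (vexp \<Omega> ?L))"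
      by (rule map_in[OF delta_hom u])
    have "?\<delta> (B_map \<Omega> A (T ?P) (tau T Tm \<Omega> t X) (?\<kappa> u)) = ?\<delta> (vpair \<omega> g)"
      using \<omega> strength_in[OF v] u
      by (simp add: kappa_apply flip: \<omega>_def v_def) (simp add: B_map_vpair g_def)
    also have "\<dots> = vlam ?L (vcase (\<lambda>q. vapp (vapp g (vfst q)) (vsnd q)) (\<lambda>_. \<omega>))"
      by (rule delta_vpair[OF \<omega> g])
    also have "\<dots> = vlam ?L (\<lambda>s. t (Tm (vexp \<Omega> ?L) \<Omega> (vev \<Omega> ?L s) (?T\<delta> u)))"
    proof (rule vlam_cong)
      fix s assume s: "s \<in> elts ?L"
      have R: "Tm (vexp \<Omega> ?L) \<Omega> (vev \<Omega> ?L s) (?T\<delta> u) = Tm ?B \<Omega> (vcomp ?B (vev \<Omega> ?L s) ?\<delta>) u"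
        by (rule map_map[OF delta_hom vev_hom[OF s] u])
      have ev\<delta>: "vev \<Omega> ?L s (?\<delta> p) = vcase (\<lambda>q. vapp (vapp (vsnd p) (vfst q)) (vsnd q)) (\<lambda>_. vfst p) s"
        if "p \<in> elts ?B" for p
        using vhom_in[OF delta_hom that] that s by (simp add: vev_def) (simp add: delta_def)
      from s show "vcase (\<lambda>q. vapp (vapp g (vfst q)) (vsnd q)) (\<lambda>_. \<omega>) s =
          t (Tm (vexp \<Omega> ?L) \<Omega> (vev \<Omega> ?L s) (?T\<delta> u))"
      proof (cases rule: L_obj_cases)
        case (1 a x)
        have "vapp (vapp g a) x = vapp (tau T Tm \<Omega> t X (Tm (vexp ?P A) ?P (vev ?P A a) v)) x"
          using 1 v by (simp add: g_def strength_apply)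
        also have "\<dots> = t (Tm ?P \<Omega> (vev \<Omega> X x) (Tm (vexp ?P A) ?P (vev ?P A a) v))"
          using 1 v by (simp add: tau_apply map_in vev_hom)
        \<comment> \<open>Unfolding \<open>v\<close> leaves three nested images under T, which
          functoriality fuses into one; it remains to identify the fused map with the one in
          \<open>R\<close>.\<close>
        also have "\<dots> = t (Tm ?B \<Omega> (vcomp ?B (vev \<Omega> X x)
            (vcomp ?B (vev ?P A a) (vproj2 \<Omega> (vexp ?P A)))) u)"
          using 1 v u p2 by (simp add: v_def map_map vev_hom vcomp_hom)
        also have "vcomp ?B (vev \<Omega> X x) (vcomp ?B (vev ?P A a) (vproj2 \<Omega> (vexp ?P A)))
            = vcomp ?B (vev \<Omega> ?L s) ?\<delta>"
        proof (rule vhom_eqI)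
          show "vcomp ?B (vev \<Omega> X x) (vcomp ?B (vev ?P A a) (vproj2 \<Omega> (vexp ?P A))) \<in> vhom ?B \<Omega>"
            using 1 by (intro vcomp_hom[OF vcomp_hom[OF p2 vev_hom] vev_hom])
          show "vcomp ?B (vev \<Omega> ?L s) ?\<delta> \<in> vhom ?B \<Omega>"
            by (rule vcomp_hom[OF delta_hom vev_hom[OF s]])
          fix p assume p: "p \<in> elts ?B"
          then obtain \<omega>' g' where "p = vpair \<omega>' g'" "g' \<in> elts (vexp ?P A)" "vapp g' a \<in> elts ?P"
            unfolding B_obj_def using 1 by (metis vprodE vapp_in)
          then show "vcomp ?B (vev \<Omega> X x) (vcomp ?B (vev ?P A a) (vproj2 \<Omega> (vexp ?P A))) p
              = vcomp ?B (vev \<Omega> ?L s) ?\<delta> p"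
            using 1 p ev\<delta>[OF p] by (simp add: compose_eq vproj2_def vev_def B_obj_def)
        qed
        finally show ?thesis using 1 R by simp
      next
        case 2
        have "vproj1 \<Omega> (vexp ?P A) = vcomp ?B (vev \<Omega> ?L s) ?\<delta>"
          by (rule vhom_eqI[OF p1 vcomp_hom[OF delta_hom vev_hom[OF s]]])
            (simp add: compose_eq ev\<delta>, simp add: 2 vproj1_def B_obj_def)
        with R 2 show ?thesis by (simp add: \<omega>_def)
      qed
    qed
    also have "\<dots> = ?\<tau> (?T\<delta> u)"
      by (rule tau_apply[OF T\<delta>, symmetric])
    finally show ?thesis .
  qed
  \<comment> \<open>The inner composite is \<open>undefined\<close> off B(T(\<Omega>^X)), so the
    pointwise equation applies only once \<open>kappa\<close> is known to land there.\<close>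
  moreover have "?\<kappa> u \<in> elts ?BT" if "u \<in> elts (T ?B)" for u
    using that unfolding B_obj_def
    by (simp add: kappa_apply[unfolded B_obj_def] vhom_in[OF t] map_in[OF vproj1_hom]
        strength_in map_in[OF vproj2_hom])
  ultimately show ?thesis
    by (auto simp: compose_def B_map_def intro!: restrict_ext)
qed

section \<open>The two semantics\<close>

text \<open>Applying \<open>zeta\<close> to both sides of the fixed-point equation separates it into
  the clause for the empty word and the clause for b w. The equivalence concerns arbitrary
  candidates \<open>h\<close>, so existence and uniqueness carry over between the two
  notions.\<close>

lemma is_em_semantics_iff_is_log_semantics:
  assumes t: "t \<in> vhom (T \<Omega>) \<Omega>" and out: "out \<in> vhom X \<Omega>" and f: "f \<in> vhom X (vexp (T X) A)"
  shows "is_em_semantics T Tm \<Omega> t A X (vtuple X out f) h \<longleftrightarrow> is_log_semantics T Tm \<Omega> t A X out f h"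
\<comment> \<open>Both predicates include this membership, so they fail together without it.\<close>
proof (cases "h \<in> vhom X (vexp \<Omega> (vstar A))")
  case h: True
  let ?Z = "vexp \<Omega> (vstar A)"
  let ?a = "tau T Tm \<Omega> t (vstar A)"
  let ?rhs = "vcomp X (B_map \<Omega> A (T ?Z) ?a) (vcomp X (B_map \<Omega> A (T X) (Tm X ?Z h)) (vtuple X out f))"
  have c: "vtuple X out f \<in> vhom X (B_obj \<Omega> A (T X))"
    unfolding vtuple_def B_obj_def by (rule vhomI) (simp add: vhom_in[OF out] vhom_in[OF f])
  have rhs: "?rhs \<in> vhom X (B_obj \<Omega> A ?Z)"
    by (intro vcomp_hom[OF vcomp_hom[OF c B_map_hom] B_map_hom] map_hom h tau_hom t)
  \<comment> \<open>The right-hand side takes the shape of a value of \<open>zeta\<close>, with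
    T(ev_w) and T(h) merged, so that components can be compared directly.\<close>
  have rhs_apply: "?rhs x = vpair (out x) (vlam A (\<lambda>b. vlam (vstar A)
      (\<lambda>w. t (Tm X \<Omega> (vcomp X (vev \<Omega> (vstar A) w) h) (vapp (f x) b)))))"
    if x: "x \<in> elts X" for x
  proof -
    have o: "out x \<in> elts \<Omega>" and fx: "f x \<in> elts (vexp (T X) A)"
      using x out f by (auto intro: vhom_in)
    have fxb: "vapp (f x) b \<in> elts (T X)" if "b \<in> elts A" for b
      by (rule vapp_in[OF fx that])
    have Th: "Tm X ?Z h (vapp (f x) b) \<in> elts (T ?Z)" if "b \<in> elts A" for b
      by (rule map_in[OF h fxb[OF that]])
    have "?rhs x = B_map \<Omega> A (T ?Z) ?a (vpair (out x) (vlam A (\<lambda>b. Tm X ?Z h (vapp (f x) b))))"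
      using x o fx by (simp add: compose_eq vtuple_def B_map_vpair)
    also have "\<dots> = vpair (out x)
        (vlam A (\<lambda>b. ?a (vapp (vlam A (\<lambda>b. Tm X ?Z h (vapp (f x) b))) b)))"
      by (rule B_map_vpair[OF o vlam_in]) (rule Th)
    also have "\<dots> = vpair (out x) (vlam A (\<lambda>b. vlam (vstar A)
        (\<lambda>w. t (Tm X \<Omega> (vcomp X (vev \<Omega> (vstar A) w) h) (vapp (f x) b)))))"
      by (auto simp: vpair_inject vlam_eq_iff tau_apply Th map_map[OF h vev_hom fxb])
    finally show ?thesis .
  qed
  have "h = vcomp X (zeta_inv \<Omega> A) ?rhs \<longleftrightarrow> (\<forall>x\<in>elts X. h x = vcomp X (zeta_inv \<Omega> A) ?rhs x)"
    by (intro iffI ballI) (erule fun_cong, blast intro: vhom_eqI[OF h vcomp_hom[OF rhs zeta_inv_hom]])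
  also have "\<dots> \<longleftrightarrow> (\<forall>x\<in>elts X. h x = zeta_inv \<Omega> A (?rhs x))"
    by (rule ball_cong) (simp_all only: compose_eq)
  also have "\<dots> \<longleftrightarrow> (\<forall>x\<in>elts X. zeta \<Omega> A (h x) = ?rhs x)"
    using eq_zeta_inv_iff[OF vhom_in[OF h] vhom_in[OF rhs]] by blast
  also have "\<dots> \<longleftrightarrow> is_log_semantics T Tm \<Omega> t A X out f h"
    using h vhom_in[OF h]
    by (auto simp: is_log_semantics_def rhs_apply zeta_def vpair_inject vlam_eq_iff)
  finally show ?thesis
    using h by (simp add: is_em_semantics_def Let_def)
qed (simp_all add: is_em_semantics_def is_log_semantics_def Let_def)

end

section \<open>Solving the logical equations by recursion on words\<close>

primrec word_semantics ::
  "('v::zfc_universe \<Rightarrow> 'v \<Rightarrow> ('v \<Rightarrow> 'v) \<Rightarrow> 'v \<Rightarrow> 'v) \<Rightarrow> 'v \<Rightarrow> ('v \<Rightarrow> 'v) \<Rightarrow> 'v \<Rightarrow>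
    ('v \<Rightarrow> 'v) \<Rightarrow> ('v \<Rightarrow> 'v) \<Rightarrow> 'v list \<Rightarrow> 'v \<Rightarrow> 'v"
  where "word_semantics Tm \<Omega> t X out f [] = out"
  | "word_semantics Tm \<Omega> t X out f (b # w) =
      (\<lambda>x\<in>elts X. t (Tm X \<Omega> (word_semantics Tm \<Omega> t X out f w) (vapp (f x) b)))"

context sets_functor
begin

text \<open>The clause for b w puts the map for w under \<open>Tm\<close>, so each stage of the
  recursion must be a whole morphism on states rather than a value at one state.\<close>

lemma word_semantics_hom:
  assumes "t \<in> vhom (T \<Omega>) \<Omega>" "out \<in> vhom X \<Omega>" "f \<in> vhom X (vexp (T X) A)" "w \<in> lists (elts A)"
  shows "word_semantics Tm \<Omega> t X out f w \<in> vhom X \<Omega>"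
  using assms(4)
proof (induction w)
  case Nil
  then show ?case using assms(2) by simp
next
  case (Cons b w)
  then show ?case unfolding word_semantics.simps
    by (intro vhomI vhom_in[OF assms(1)] map_in vapp_in[OF vhom_in[OF assms(3)]]) auto
qed

text \<open>Tabulating \<open>word_semantics\<close> over all words gives a solution; induction on
  words shows that every solution has these values.\<close>

lemma ex1_is_log_semantics:
  assumes t: "t \<in> vhom (T \<Omega>) \<Omega>" and out: "out \<in> vhom X \<Omega>" and f: "f \<in> vhom X (vexp (T X) A)"
  shows "\<exists>!l. is_log_semantics T Tm \<Omega> t A X out f l"
proof
  let ?S = "word_semantics Tm \<Omega> t X out f"
  \<comment> \<open>\<open>inv vword\<close> decodes an encoded word; as \<open>vword\<close> is
    injective and the table ranges only over \<open>vstar A\<close>, no arbitrary value of the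
    inverse enters.\<close>
  define l where "l = (\<lambda>x\<in>elts X. vlam (vstar A) (\<lambda>u. ?S (inv vword u) x))"
  have inv: "inv vword (vword w) = w" for w :: "'v list"
    by (rule inv_f_f) (simp add: inj_def vword_inject)
  have l: "l \<in> vhom X (vexp \<Omega> (vstar A))"
    unfolding l_def
    by (intro vhomI vlam_in)
      (auto simp: elts_vstar inv intro!: vhom_in[OF word_semantics_hom[OF t out f]])
  have app: "vapp (l x) (vword w) = ?S w x" if "x \<in> elts X" "w \<in> lists (elts A)" for x w
    using that by (simp add: l_def elts_vstar inv)
  \<comment> \<open>Equality of maps, including their behaviour off X, is required here because the
    map is an argument of \<open>Tm\<close>.\<close>
  have comp: "vcomp X (vev \<Omega> (vstar A) (vword w)) l = ?S w" if w: "w \<in> lists (elts A)" for w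
  proof (rule vhom_eqI[OF vcomp_hom[OF l vev_hom] word_semantics_hom[OF t out f w]])
    show "vword w \<in> elts (vstar A)" using w by (simp add: elts_vstar)
    show "vcomp X (vev \<Omega> (vstar A) (vword w)) l x = ?S w x" if "x \<in> elts X" for x
      using that w vhom_in[OF l that] by (simp add: compose_eq vev_def app)
  qed
  show "is_log_semantics T Tm \<Omega> t A X out f l"
    unfolding is_log_semantics_def
  proof (intro conjI ballI l)
    show "vapp (l x) (vword []) = out x" if "x \<in> elts X" for x
      using app[OF that, of "[]"] by simp
    fix x b u assume x: "x \<in> elts X" and b: "b \<in> elts A" and "u \<in> elts (vstar A)"
    then obtain w where w: "u = vword w" "w \<in> lists (elts A)"
      by (auto simp: elts_vstar)
    then show "vapp (l x) (vpair b u) = t (Tm X \<Omega> (vcomp X (vev \<Omega> (vstar A) u) l) (vapp (f x) b))"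
      using app[OF x, of "b # w"] x b by (simp add: comp)
  qed
  fix k assume k: "is_log_semantics T Tm \<Omega> t A X out f k"
  then have khom: "k \<in> vhom X (vexp \<Omega> (vstar A))"
    by (simp add: is_log_semantics_def)
  \<comment> \<open>The quantifier over states stays inside the induction: the step for b w needs
    the hypothesis at all states to identify ev_w after k with the stage for w.\<close>
  have k_app: "\<forall>x\<in>elts X. vapp (k x) (vword w) = ?S w x" if "w \<in> lists (elts A)" for w
    using that
  proof (induction w)
    case Nil
    then show ?case using k by (simp add: is_log_semantics_def)
  next
    case (Cons b w)
    then have w: "w \<in> lists (elts A)" "vword w \<in> elts (vstar A)" by (auto simp: elts_vstar)
    have "vcomp X (vev \<Omega> (vstar A) (vword w)) k = ?S w"
      by (rule vhom_eqI[OF vcomp_hom[OF khom vev_hom[OF w(2)]] word_semantics_hom[OF t out f w(1)]])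
        (use Cons.IH vhom_in[OF khom] in \<open>simp add: compose_eq vev_def\<close>)
    then show ?case
      using k Cons.hyps w by (simp add: is_log_semantics_def)
  qed
  show "k = l"
  proof (rule vhom_eqI[OF khom l])
    fix x assume x: "x \<in> elts X"
    show "k x = l x"
    proof (rule vexp_eqI[OF vhom_in[OF khom x] vhom_in[OF l x]])
      fix u assume "u \<in> elts (vstar A)"
      then obtain w where "u = vword w" "w \<in> lists (elts A)"
        by (auto simp: elts_vstar)
      then show "vapp (k x) u = vapp (l x) u"
        using app k_app x by metis
    qed
  qed
qed

text \<open>Both sides are definite descriptions, and the equivalence of candidates makes the
  described predicates equal.\<close>

lemma em_semantics_eq_log_semantics:
  assumes "t \<in> vhom (T \<Omega>) \<Omega>" "out \<in> vhom X \<Omega>" "f \<in> vhom X (vexp (T X) A)"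
  shows "em_semantics T Tm \<Omega> t A X (vtuple X out f) = log_semantics T Tm \<Omega> t A X out f"
  by (simp add: em_semantics_def log_semantics_def is_em_semantics_iff_is_log_semantics[OF assms])

text \<open>Unique existence gives the description its defining property. Being a morphism is what
  lets composition with the identity return the map unchanged.\<close>

lemma log_semantics_hom:
  assumes "t \<in> vhom (T \<Omega>) \<Omega>" "out \<in> vhom X \<Omega>" "f \<in> vhom X (vexp (T X) A)"
  shows "log_semantics T Tm \<Omega> t A X out f \<in> vhom X (vexp \<Omega> (vstar A))"
  using theI'[OF ex1_is_log_semantics[OF assms]]
  by (simp add: log_semantics_def is_log_semantics_def)

end

theorem theorem7p6:
  fixes T :: "'v::zfc_universe \<Rightarrow> 'v"
    and Tm :: "'v \<Rightarrow> 'v \<Rightarrow> ('v \<Rightarrow> 'v) \<Rightarrow> 'v \<Rightarrow> 'v"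
    and eta mu :: "'v \<Rightarrow> 'v \<Rightarrow> 'v"
    and \<Omega> A :: 'v
    and t :: "'v \<Rightarrow> 'v"
  assumes "sets_monad T Tm eta mu"
    and "em_algebra T Tm eta mu \<Omega> t"
  shows "(\<forall>X.
      vcomp (T (B_obj \<Omega> A (vexp \<Omega> X)))
        (vcomp (B_obj \<Omega> A (T (vexp \<Omega> X)))
          (delta \<Omega> A X)
          (vprod_map \<Omega> (vexp (T (vexp \<Omega> X)) A)
            (vid \<Omega>) (vexp_map (T (vexp \<Omega> X)) A (tau T Tm \<Omega> t X))))
        (kappa T Tm \<Omega> t A (vexp \<Omega> X)) =
      vcomp (T (B_obj \<Omega> A (vexp \<Omega> X)))
        (tau T Tm \<Omega> t (L_obj A X))
        (Tm (B_obj \<Omega> A (vexp \<Omega> X)) (vexp \<Omega> (L_obj A X)) (delta \<Omega> A X)))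
    \<and> (\<exists>e \<in> vhom (vexp \<Omega> (vstar A)) (vexp \<Omega> (vstar A)).
        bij_betw e (elts (vexp \<Omega> (vstar A))) (elts (vexp \<Omega> (vstar A))) \<and>
        (\<forall>X. \<forall>out \<in> vhom X \<Omega>. \<forall>f \<in> vhom X (vexp (T X) A).
          vcomp X e (em_semantics T Tm \<Omega> t A X (vtuple X out f)) =
            log_semantics T Tm \<Omega> t A X out f))"
proof -
  interpret em_algebra T Tm eta mu \<Omega> t by (rule assms(2))
  have "vid (vexp \<Omega> (vstar A)) \<in> vhom (vexp \<Omega> (vstar A)) (vexp \<Omega> (vstar A))"
    by (rule vid_hom)
  moreover have "bij_betw (vid (vexp \<Omega> (vstar A))) (elts (vexp \<Omega> (vstar A))) (elts (vexp \<Omega> (vstar A)))"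
    by (rule bij_betw_imageI) (auto simp: vid_def inj_on_def)
  moreover have "vcomp X (vid (vexp \<Omega> (vstar A))) (em_semantics T Tm \<Omega> t A X (vtuple X out f)) =
      log_semantics T Tm \<Omega> t A X out f"
    if "out \<in> vhom X \<Omega>" "f \<in> vhom X (vexp (T X) A)" for X out f
    using that alg_hom
    by (simp add: em_semantics_eq_log_semantics vcomp_vid_left[OF log_semantics_hom])
  ultimately show ?thesis
    using delta_tau_kappa[OF alg_hom] by blast
qed

end
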